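(* Let $I\subseteq\mathbb{R}$ be a nonempty open interval, let $\alpha:(I-I)\to\mathbb{R}_+$ be an even function, and let $L:I\to\mathbb{R}$ be a strongly $\alpha$-convex function. Then $$L\bigg(\sum_{i=1}^n t_ix_i\bigg)\leq\sum_{i=1}^n t_iL(x_i)-\sum_{i=1}^n t_i\,\alpha\bigg(x_i-\sum_{j=1}^n t_jx_j\bigg)$$ for all $n\in\mathbb{N}$, all $x_1,\ldots,x_n\in I$, and all $t_1,\ldots,t_n\in[0,1]$ satisfying $t_1+\cdots+t_n=1$.
   Context: $\mathbb{N}$ is the set of positive integers, $\mathbb{R}_+=[0,\infty)$, and $I-I:=\{x-y: x,y\in I\}$. Strong $\alpha$-convexity: for a nondegenerate interval $I\subseteq\mathbb{R}$ and an even function $\alpha:(I-I)\to\mathbb{R}_+$, a function $L:I\to\mathbb{R}$ is strongly $\alpha$-convex if $L(tx+(1-t)y)\leq tL(x)+(1-t)L(y)-t\,\alpha((1-t)(x-y))-(1-t)\,\alpha(t(y-x))$ for all $x,y\in I$ and $t\in[0,1]$. *)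

theory Defs
  imports "HOL-Analysis.Analysis" "HOL-Library.FuncSet"
begin

text \<open>The Minkowski difference of a set with itself; on sets, the library's infix minus is the
  set-theoretic difference.\<close>

definition difference_set :: "real set \<Rightarrow> real set" where
  "difference_set I = {x - y | x y. x \<in> I \<and> y \<in> I}"

definition even_fun_on :: "real set \<Rightarrow> (real \<Rightarrow> real) \<Rightarrow> bool" where
  "even_fun_on D \<alpha> \<longleftrightarrow> (\<forall>u\<in>D. \<alpha> (- u) = \<alpha> u)"

text \<open>Functions on \<open>I\<close> and on \<open>difference_set I\<close> are rendered as total functions whose values
  outside these sets are irrelevant. For an interval \<open>I\<close> the inequality evaluates \<open>L\<close> and \<open>\<alpha>\<close> only
  inside them: for instance \<open>(1 - t) * (x - y) = x - (t * x + (1 - t) * y)\<close>.\<close>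

definition strongly_alpha_convex_on ::
    "real set \<Rightarrow> (real \<Rightarrow> real) \<Rightarrow> (real \<Rightarrow> real) \<Rightarrow> bool" where
  "strongly_alpha_convex_on I \<alpha> L \<longleftrightarrow>
    (\<forall>x\<in>I. \<forall>y\<in>I. \<forall>t\<in>{0..1}.
      L (t * x + (1 - t) * y)
        \<le> t * L x + (1 - t) * L y - t * \<alpha> ((1 - t) * (x - y)) - (1 - t) * \<alpha> (t * (y - x)))"

end

theory Submission
  imports Defs
begin

text \<open>
  The inequality is Jensen's, proved by a supporting line. Fix a point \<open>p\<close> of \<open>I\<close> and put
  \<open>g u = L u - \<alpha> (u - p)\<close>. Written at the point \<open>p = s x + (1 - s) y\<close>, strong
  \<open>\<alpha>\<close>-convexity says \<open>L p \<le> s g x + (1 - s) g y\<close>, because the two arguments of \<open>\<alpha>\<close> in it are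
  \<open>x - p\<close> and \<open>y - p\<close>. So the chords of \<open>g\<close> from \<open>(p, L p)\<close> to points on the left of \<open>p\<close> have
  slopes at most those of the chords to points on the right
  (\<open>strongly_alpha_convex_on_chord_slopes\<close>), and any number \<open>c\<close> between these two families gives
  \<open>L p + c (u - p) \<le> L u - \<alpha> (u - p)\<close> on all of \<open>I\<close>
  (\<open>strongly_alpha_convex_on_supporting_line\<close>). Taking for \<open>p\<close> the weighted mean of the
  \<open>x i\<close> and averaging these inequalities, the linear term cancels and the claim remains.
\<close>

lemma strongly_alpha_convex_on_zero:
  assumes "strongly_alpha_convex_on I \<alpha> L" and "p \<in> I"
  shows "\<alpha> 0 \<le> 0"
proof -
  have "L (1 * p + (1 - 1) * p) \<le> 1 * L p + (1 - 1) * L p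
      - 1 * \<alpha> ((1 - 1) * (p - p)) - (1 - 1) * \<alpha> (1 * (p - p))"
    using assms unfolding strongly_alpha_convex_on_def by (meson atLeastAtMost_iff order_refl zero_le_one)
  then show ?thesis by simp
qed

lemma strongly_alpha_convex_on_chord_slopes:
  assumes sc: "strongly_alpha_convex_on I \<alpha> L"
    and I: "x \<in> I" "y \<in> I" and ord: "y < p" "p < x"
  shows "(L p - (L y - \<alpha> (y - p))) / (p - y) \<le> ((L x - \<alpha> (x - p)) - L p) / (x - p)"
proof -
  define s where "s = (p - y) / (x - y)"
  have s: "s \<in> {0..1}" and s': "s * (x - y) = p - y"
    using ord by (auto simp: s_def field_simps)
  have args: "s * x + (1 - s) * y = p" "(1 - s) * (x - y) = x - p" "s * (y - x) = y - p"
    using s' by (simp_all add: algebra_simps)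
  have "L (s * x + (1 - s) * y) \<le> s * L x + (1 - s) * L y
      - s * \<alpha> ((1 - s) * (x - y)) - (1 - s) * \<alpha> (s * (y - x))"
    using sc I s unfolding strongly_alpha_convex_on_def by blast
  then have "L p \<le> s * (L x - \<alpha> (x - p)) + (1 - s) * (L y - \<alpha> (y - p))"
    unfolding args by (simp add: algebra_simps)
  then have "(x - y) * L p \<le> (x - y) * (s * (L x - \<alpha> (x - p)) + (1 - s) * (L y - \<alpha> (y - p)))"
    using ord by (intro mult_left_mono) auto
  also have "\<dots> = (s * (x - y)) * (L x - \<alpha> (x - p)) + ((1 - s) * (x - y)) * (L y - \<alpha> (y - p))"
    by (simp add: algebra_simps)
  also have "\<dots> = (p - y) * (L x - \<alpha> (x - p)) + (x - p) * (L y - \<alpha> (y - p))"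
    unfolding s' args ..
  finally have "(L p - (L y - \<alpha> (y - p))) * (x - p) \<le> ((L x - \<alpha> (x - p)) - L p) * (p - y)"
    by (simp add: algebra_simps)
  then show ?thesis
    using ord by (simp add: divide_simps)
qed

text \<open>
  Openness of \<open>I\<close> puts points of \<open>I\<close> on both sides of \<open>p\<close>, so the slopes of the left chords form
  a nonempty set bounded above by the slope of any right chord; their supremum serves as \<open>c\<close>.
  At \<open>u = p\<close> itself the claim reduces to \<open>\<alpha> 0 \<le> 0\<close>.
\<close>

lemma strongly_alpha_convex_on_supporting_line:
  assumes sc: "strongly_alpha_convex_on I \<alpha> L" and "open I" and p: "p \<in> I"
  obtains c where "\<And>u. u \<in> I \<Longrightarrow> L p + c * (u - p) \<le> L u - \<alpha> (u - p)"
proof -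
  obtain e where e: "e > 0" "ball p e \<subseteq> I"
    using \<open>open I\<close> p by (meson open_contains_ball)
  have "p - e / 2 \<in> ball p e" "p + e / 2 \<in> ball p e"
    using e by (auto simp: dist_real_def)
  with e have left: "p - e / 2 \<in> I" "p - e / 2 < p" and right: "p + e / 2 \<in> I" "p < p + e / 2"
    by auto
  define slope where "slope y = (L p - (L y - \<alpha> (y - p))) / (p - y)" for y
  define A where "A = slope ` {y \<in> I. y < p}"
  have bound: "a \<le> ((L x - \<alpha> (x - p)) - L p) / (x - p)" if "a \<in> A" "x \<in> I" "p < x" for a x
    using that strongly_alpha_convex_on_chord_slopes[OF sc] by (auto simp: A_def slope_def)
  have ne: "A \<noteq> {}"
    using left by (auto simp: A_def)
  have bdd: "bdd_above A"
    by (rule bdd_aboveI) (rule bound[OF _ right])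
  have "L p + Sup A * (u - p) \<le> L u - \<alpha> (u - p)" if u: "u \<in> I" for u
  proof -
    consider "u < p" | "u = p" | "p < u" by linarith
    then show ?thesis
    proof cases
      case 1
      then have "slope u \<le> Sup A"
        using u bdd by (intro cSup_upper) (auto simp: A_def)
      with 1 show ?thesis
        by (simp add: slope_def pos_divide_le_eq algebra_simps)
    next
      case 2
      then show ?thesis
        using strongly_alpha_convex_on_zero[OF sc p] by simp
    next
      case 3
      then have "Sup A \<le> ((L u - \<alpha> (u - p)) - L p) / (u - p)"
        using u ne bound by (intro cSup_least) auto
      with 3 show ?thesis
        by (simp add: pos_le_divide_eq algebra_simps)
    qed
  qed
  then show thesis by (rule that)
qed

theorem corollary2p14:
  fixes I :: "real set" and \<alpha> L :: "real \<Rightarrow> real"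
    and n :: nat and x t :: "nat \<Rightarrow> real"
  assumes "is_interval I" and "open I" and "I \<noteq> {}"
    and "\<alpha> \<in> difference_set I \<rightarrow> {0..}"
    and "even_fun_on (difference_set I) \<alpha>"
    and "strongly_alpha_convex_on I \<alpha> L"
    and "n \<ge> 1"
    and "\<And>i. i \<in> {1..n} \<Longrightarrow> x i \<in> I"
    and "\<And>i. i \<in> {1..n} \<Longrightarrow> t i \<in> {0..1}"
    and "(\<Sum>i = 1..n. t i) = 1"
  shows "L (\<Sum>i = 1..n. t i * x i)
    \<le> (\<Sum>i = 1..n. t i * L (x i))
      - (\<Sum>i = 1..n. t i * \<alpha> (x i - (\<Sum>j = 1..n. t j * x j)))"
proof -
  define p where "p = (\<Sum>i = 1..n. t i * x i)"
  have "p \<in> I"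
    using convex_sum[of "{1..n}" I t x] assms(1,8-10)
    by (simp add: p_def is_interval_convex)
  then obtain c where c: "\<And>u. u \<in> I \<Longrightarrow> L p + c * (u - p) \<le> L u - \<alpha> (u - p)"
    using strongly_alpha_convex_on_supporting_line assms(2,6) by blast
  have "(\<Sum>i = 1..n. t i * (L p + c * (x i - p))) = (\<Sum>i = 1..n. t i) * (L p - c * p) + c * p"
    unfolding p_def by (simp add: algebra_simps sum.distrib sum_subtractf
        flip: sum_distrib_left sum_distrib_right)
  then have "L p = (\<Sum>i = 1..n. t i * (L p + c * (x i - p)))"
    using assms(10) by simp
  also have "\<dots> \<le> (\<Sum>i = 1..n. t i * (L (x i) - \<alpha> (x i - p)))"
    using assms(8,9) c by (intro sum_mono mult_left_mono) auto
  also have "\<dots> = (\<Sum>i = 1..n. t i * L (x i)) - (\<Sum>i = 1..n. t i * \<alpha> (x i - p))"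
    by (simp add: right_diff_distrib sum_subtractf)
  finally show ?thesis
    unfolding p_def .
qed

end
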